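(* Let $R$ be a finite proper nearfield and let $n\ge 0$, $\ell\ge 0$ be integers. Then the number $\operatorname{Sub}(R,\ell,n)$ of $R$-subgroups of $R^n$ of dimension $\ell$ is $$\operatorname{Sub}(R,\ell,n)=\sum_{d=0}^{n-\ell}\binom{n}{d}\begin{Bmatrix}n-d\\ \ell\end{Bmatrix}\big(|R|-1\big)^{n-d-\ell},$$ where $\begin{Bmatrix}m\\ k\end{Bmatrix}$ denotes the Stirling number of the second kind.
   Context: A (left) nearfield is a set $R$ with two operations $+,\cdot$ such that $(R,+)$ is a group (it is automatically abelian), multiplication is associative, $a(b+c)=ab+ac$ for all $a,b,c\in R$, $0\cdot r=r\cdot 0=0$ for all $r\in R$, and $R\setminus\{0\}$ is a group under multiplication. A nearfield $R$ is proper if it is not a skewfield, i.e. there exist $a,b,c\in R$ with $(a+b)c\ne ac+bc$. $R^n$ carries coordinatewise addition and the right scalar multiplication $(v_1,\ldots,v_n)r=(v_1r,\ldots,v_nr)$ for $r\in R$ (with $R^0=\{0\}$). An $R$-subgroup of $R^n$ is a subgroup $H$ of $(R^n,+)$ such that $hr\in H$ for all $h\in H$, $r\in R$. The support of $u\in R^n$ is $\operatorname{supp}(u)=\{1\le i\le n:u_i\neq 0\}$, and $uR=\{ur:r\in R\}$. When $R$ is proper, every $R$-subgroup $T$ of $R^n$ can be written as an internal direct sum $T=\bigoplus_{i=1}^\ell u_iR$ with $u_1,\ldots,u_\ell\in R^n$ nonzero vectors with mutually disjoint supports ($\ell\ge 0$), and the number $\ell$ is uniquely determined by $T$; the dimension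 of $T$ is $\dim(T)=\ell$. The Stirling number of the second kind $\begin{Bmatrix}m\\ k\end{Bmatrix}$ is the number of partitions of an $m$-element set into $k$ nonempty blocks (with $\begin{Bmatrix}0\\ 0\end{Bmatrix}=1$). An empty sum (when $\ell>n$) is $0$. *)

theory Defs
  imports
    "HOL-Algebra.Product_Groups"
    "HOL-Algebra.Ring"
    "HOL-Combinatorics.Stirling"
    "HOL-Library.Disjoint_Sets"
begin

text \<open>Left nearfields. Addition is not assumed to be commutative, since this follows from the
  other axioms.\<close>

locale nearfield =
  fixes R (structure)
  assumes add_group: "group (add_monoid R)"
    and m_closed: "\<lbrakk>a \<in> carrier R; b \<in> carrier R\<rbrakk> \<Longrightarrow> a \<otimes> b \<in> carrier R"
    and m_assoc: "\<lbrakk>a \<in> carrier R; b \<in> carrier R; c \<in> carrier R\<rbrakk> \<Longrightarrow>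
      (a \<otimes> b) \<otimes> c = a \<otimes> (b \<otimes> c)"
    and distrib_left: "\<lbrakk>a \<in> carrier R; b \<in> carrier R; c \<in> carrier R\<rbrakk> \<Longrightarrow>
      a \<otimes> (b \<oplus> c) = a \<otimes> b \<oplus> a \<otimes> c"
    and zero_mult: "r \<in> carrier R \<Longrightarrow> \<zero> \<otimes> r = \<zero>"
    and mult_zero: "r \<in> carrier R \<Longrightarrow> r \<otimes> \<zero> = \<zero>"
    and mult_group: "group (R\<lparr>carrier := carrier R - {\<zero>}\<rparr>)"

locale proper_nearfield = nearfield +
  assumes not_distrib_right: "\<exists>a\<in>carrier R. \<exists>b\<in>carrier R. \<exists>c\<in>carrier R.
    (a \<oplus> b) \<otimes> c \<noteq> a \<otimes> c \<oplus> b \<otimes> c"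

text \<open>The group \<open>R\<^sup>n\<close>, written multiplicatively as a monoid record: its elements are the functions
  on \<open>{1..n}\<close> with values in \<open>R\<close> (and \<open>undefined\<close> elsewhere), its product is coordinatewise
  addition, and its \<open>\<one>\<close> is the zero vector.\<close>

definition vec_group :: "('a, 'b) ring_scheme \<Rightarrow> nat \<Rightarrow> (nat \<Rightarrow> 'a) monoid" where
  "vec_group R n = product_group {1..n} (\<lambda>_. add_monoid R)"

definition scalar_mult :: "('a, 'b) ring_scheme \<Rightarrow> nat \<Rightarrow> (nat \<Rightarrow> 'a) \<Rightarrow> 'a \<Rightarrow> (nat \<Rightarrow> 'a)" where
  "scalar_mult R n v r = (\<lambda>i\<in>{1..n}. v i \<otimes>\<^bsub>R\<^esub> r)"

definition R_subgroup :: "('a, 'b) ring_scheme \<Rightarrow> nat \<Rightarrow> (nat \<Rightarrow> 'a) set \<Rightarrow> bool" where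
  "R_subgroup R n H \<longleftrightarrow> subgroup H (vec_group R n) \<and>
     (\<forall>h\<in>H. \<forall>r\<in>carrier R. scalar_mult R n h r \<in> H)"

definition supp :: "('a, 'b) ring_scheme \<Rightarrow> nat \<Rightarrow> (nat \<Rightarrow> 'a) \<Rightarrow> nat set" where
  "supp R n u = {i \<in> {1..n}. u i \<noteq> \<zero>\<^bsub>R\<^esub>}"

definition multiples :: "('a, 'b) ring_scheme \<Rightarrow> nat \<Rightarrow> (nat \<Rightarrow> 'a) \<Rightarrow> (nat \<Rightarrow> 'a) set" where
  "multiples R n u = {scalar_mult R n u r | r. r \<in> carrier R}"

text \<open>\<open>T\<close> is the internal direct sum of the subgroups \<open>A i\<close>, \<open>i \<in> I\<close> (\<open>I\<close> finite, \<open>G\<close> commutative):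
  every element of \<open>T\<close> is, for exactly one family \<open>x\<close> with \<open>x i \<in> A i\<close>, the sum of the \<open>x i\<close>,
  and all such sums lie in \<open>T\<close>.\<close>

definition internal_direct_sum ::
    "('a, 'b) monoid_scheme \<Rightarrow> 'i set \<Rightarrow> ('i \<Rightarrow> 'a set) \<Rightarrow> 'a set \<Rightarrow> bool" where
  "internal_direct_sum G I A T \<longleftrightarrow> (\<forall>i\<in>I. subgroup (A i) G) \<and>
     bij_betw (\<lambda>x. finprod G x I) (\<Pi>\<^sub>E i\<in>I. A i) T"

definition has_disjoint_decomposition ::
    "('a, 'b) ring_scheme \<Rightarrow> nat \<Rightarrow> (nat \<Rightarrow> 'a) set \<Rightarrow> nat \<Rightarrow> bool" where
  "has_disjoint_decomposition R n T l \<longleftrightarrow>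
     (\<exists>u. (\<forall>i\<in>{1..l}. u i \<in> carrier (vec_group R n) \<and> u i \<noteq> \<one>\<^bsub>vec_group R n\<^esub>) \<and>
          disjoint_family_on (\<lambda>i. supp R n (u i)) {1..l} \<and>
          internal_direct_sum (vec_group R n) {1..l} (\<lambda>i. multiples R n (u i)) T)"

text \<open>For a proper nearfield \<open>R\<close> and an \<open>R\<close>-subgroup \<open>T\<close> of \<open>R\<^sup>n\<close>, such an \<open>l\<close> exists and is
  unique.\<close>

definition dimension :: "('a, 'b) ring_scheme \<Rightarrow> nat \<Rightarrow> (nat \<Rightarrow> 'a) set \<Rightarrow> nat" where
  "dimension R n T = (THE l. has_disjoint_decomposition R n T l)"

definition Sub :: "('a, 'b) ring_scheme \<Rightarrow> nat \<Rightarrow> nat \<Rightarrow> nat" where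
  "Sub R l n = card {T. R_subgroup R n T \<and> dimension R n T = l}"

end

theory Submission
  imports Defs
begin

text \<open>An \<open>R\<close>-subgroup \<open>T = u\<^sub>1R \<oplus> \<dots> \<oplus> u\<^sub>lR\<close> of \<open>R\<^sup>n\<close> becomes unique combinatorial data once every \<open>u\<^sub>j\<close>
  is scaled to have entry \<open>1\<close> at the least element of its support, its pivot: each coordinate outside
  all supports is marked as vanishing, and each other non-pivot coordinate records its pivot and a
  nonzero factor. Appending one coordinate to such data with \<open>l\<close> pivots adds a vanishing coordinate,
  a new pivot, or one of \<open>l (|R| - 1)\<close> pairs, so the counts satisfy
  \<open>f(n + 1, l) = (1 + l (|R| - 1)) f(n, l) + f(n, l - 1)\<close>, as does the right-hand side.

  That every \<open>T\<close> arises in this way uses properness: if \<open>(a + b)c \<noteq> ac + bc\<close> and \<open>v, w \<in> T\<close> have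
  entry \<open>1\<close> at \<open>i\<close>, then \<open>(va + wb)c - (vac + wbc) \<in> T\<close> is nonzero at \<open>i\<close> and supported in
  \<open>supp v \<inter> supp w\<close>. Hence \<open>T\<close> contains, for each pivot, a vector vanishing at all other pivots. The
  dimension is well defined because \<open>|T| = |R|\<^sup>l\<close>.\<close>

subsection \<open>Commutativity of addition in finite nearfields\<close>

lemma (in group) exponent_two_imp_comm_group:
  assumes "\<And>x. x \<in> carrier G \<Longrightarrow> x \<otimes> x = \<one>"
  shows "comm_group G"
proof (rule group_comm_groupI)
  have inv: "inv x = x" if "x \<in> carrier G" for x
    using assms that by (simp add: inv_equality)
  show "x \<otimes> y = y \<otimes> x" if "x \<in> carrier G" "y \<in> carrier G" for x y
    using inv_mult_group[of x y] inv that by simp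
qed

text \<open>If \<open>d x = d y\<close>, then \<open>x \<otimes> inv y\<close> is fixed by
  \<open>s\<close>, so \<open>d\<close> is injective, and by finiteness surjective. As
  \<open>s\<close> inverts every value of \<open>d\<close>, inversion is a homomorphism, which
  forces commutativity.\<close>

lemma (in group) fixpoint_free_involution_imp_comm_group:
  assumes fin: "finite (carrier G)" and hom: "s \<in> hom G G"
    and invol: "\<And>x. x \<in> carrier G \<Longrightarrow> s (s x) = x"
    and fixpoint: "\<And>x. \<lbrakk>x \<in> carrier G; s x = x\<rbrakk> \<Longrightarrow> x = \<one>"
  shows "comm_group G"
proof -
  interpret s: group_hom G G s
    using hom by unfold_locales
  define d where "d x = inv x \<otimes> s x" for x
  have "inj_on d (carrier G)"
  proof (rule inj_onI)
    fix x y assume xy: "x \<in> carrier G" "y \<in> carrier G" and eq: "d x = d y"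
    have "x \<otimes> inv y = x \<otimes> d y \<otimes> inv (s y)"
      using xy by (simp add: d_def m_assoc)
    also have "\<dots> = s (x \<otimes> inv y)"
      unfolding eq[symmetric] using xy by (simp add: d_def m_assoc[symmetric])
    finally have "x \<otimes> inv y = \<one>"
      using fixpoint xy by (metis inv_closed m_closed)
    then show "x = y"
      using xy by (metis inv_equality inv_inv inv_closed)
  qed
  then have surj: "d ` carrier G = carrier G"
    by (intro endo_inj_surj fin) (auto simp: d_def)
  \<comment> \<open>So \<open>s\<close> maps every element \<open>x\<inverse> s(x)\<close>, that is, every element, to its inverse.\<close>
  have s_inv: "s x = inv x" if "x \<in> carrier G" for x
  proof -
    obtain y where y: "y \<in> carrier G" "x = d y"
      using surj \<open>x \<in> carrier G\<close> by blast
    then show ?thesis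
      by (simp add: d_def invol inv_mult_group)
  qed
  show ?thesis
  proof (rule group_comm_groupI)
    fix x y assume xy: "x \<in> carrier G" "y \<in> carrier G"
    then have "inv (x \<otimes> y) = inv x \<otimes> inv y"
      using s_inv s.hom_mult by (metis m_closed)
    also have "\<dots> = inv (y \<otimes> x)"
      using xy by (simp add: inv_mult_group)
    finally show "x \<otimes> y = y \<otimes> x"
      using xy by (metis inv_inv m_closed)
  qed
qed

context nearfield
begin

lemma one_closed: "\<one> \<in> carrier R" and one_not_zero: "\<one> \<noteq> \<zero>"
  using monoid.one_closed[OF group.is_monoid[OF mult_group]] by simp_all

lemma one_mult: "r \<in> carrier R \<Longrightarrow> \<one> \<otimes> r = r"
  using monoid.l_one[OF group.is_monoid[OF mult_group], of r] mult_zero[OF one_closed]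
  by (cases "r = \<zero>") simp_all

lemma mult_one: "r \<in> carrier R \<Longrightarrow> r \<otimes> \<one> = r"
  using monoid.r_one[OF group.is_monoid[OF mult_group], of r] zero_mult[OF one_closed]
  by (cases "r = \<zero>") simp_all

lemma mult_nonzero:
  assumes "a \<in> carrier R" "b \<in> carrier R" "a \<noteq> \<zero>" "b \<noteq> \<zero>"
  shows "a \<otimes> b \<noteq> \<zero>"
  using monoid.m_closed[OF group.is_monoid[OF mult_group], of a b] assms by simp

lemma inverse_exists:
  assumes "r \<in> carrier R" "r \<noteq> \<zero>"
  obtains s where "s \<in> carrier R" "s \<noteq> \<zero>" "r \<otimes> s = \<one>" "s \<otimes> r = \<one>"
  using group.l_inv_ex[OF mult_group, of r] group.r_inv_ex[OF mult_group, of r] assms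
    monoid.inv_unique[OF group.is_monoid[OF mult_group]]
  by (auto simp: Bex_def)

lemma mult_right_cancel:
  assumes "a \<in> carrier R" "b \<in> carrier R" "r \<in> carrier R" "r \<noteq> \<zero>" "a \<otimes> r = b \<otimes> r"
  shows "a = b"
  using assms by (metis inverse_exists m_assoc mult_one)

lemma mult_left_cancel:
  assumes "a \<in> carrier R" "b \<in> carrier R" "r \<in> carrier R" "r \<noteq> \<zero>" "r \<otimes> a = r \<otimes> b"
  shows "a = b"
  using assms by (metis inverse_exists m_assoc one_mult)

lemma left_mult_hom: "a \<in> carrier R \<Longrightarrow> (\<lambda>x. a \<otimes> x) \<in> hom (add_monoid R) (add_monoid R)"
  by (rule homI) (simp_all add: m_closed distrib_left)

lemma mult_minus:
  assumes "a \<in> carrier R" "b \<in> carrier R"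
  shows "a \<otimes> (\<ominus> b) = \<ominus> (a \<otimes> b)"
proof -
  interpret h: group_hom "add_monoid R" "add_monoid R" "\<lambda>x. a \<otimes> x"
    using add_group left_mult_hom[OF assms(1)]
    by (simp add: group_hom_def group_hom_axioms_def)
  show ?thesis
    using h.hom_inv[of b] assms by (simp add: a_inv_def)
qed

end

locale finite_nearfield = nearfield +
  assumes finite_carrier: "finite (carrier R)"
begin

text \<open>Left multiplication by \<open>\<ominus> \<one>\<close> is an additive involution. If
  \<open>\<ominus> \<one> = \<one>\<close>, every element is its own negative; otherwise right
  cancellation shows that the involution fixes only zero.\<close>

lemma abelian_group: "abelian_group R"
proof (rule comm_group_abelian_groupI)
  interpret A: group "add_monoid R" by (rule add_group)
  have minus_one: "\<ominus> \<one> \<in> carrier R"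
    using A.inv_closed one_closed by (simp add: a_inv_def)
  have minus_minus: "\<ominus> (\<ominus> x) = x" if "x \<in> carrier R" for x
    using A.inv_inv that by (simp add: a_inv_def)
  have square: "\<ominus> \<one> \<otimes> \<ominus> \<one> = \<one>"
    using minus_one by (simp add: mult_minus mult_one one_closed minus_minus)
  show "comm_group (add_monoid R)"
  proof (cases "\<ominus> \<one> = \<one>")
    case True
    have "x \<oplus> x = \<zero>" if "x \<in> carrier R" for x
    proof -
      have "x \<oplus> x = x \<oplus> \<ominus> x"
        using mult_minus[OF that one_closed] that by (simp add: True mult_one)
      then show ?thesis
        using A.r_inv that by (simp add: a_inv_def)
    qed
    then show ?thesis
      using A.exponent_two_imp_comm_group by simp
  next
    case False
    show ?thesis
    proof (rule A.fixpoint_free_involution_imp_comm_group)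
      show "(\<lambda>x. \<ominus> \<one> \<otimes> x) \<in> hom (add_monoid R) (add_monoid R)"
        by (rule left_mult_hom[OF minus_one])
      show "\<ominus> \<one> \<otimes> (\<ominus> \<one> \<otimes> x) = x" if "x \<in> carrier (add_monoid R)" for x
        using that minus_one square by (simp add: m_assoc[symmetric] one_mult)
      show "x = \<one>\<^bsub>add_monoid R\<^esub>"
        if "x \<in> carrier (add_monoid R)" "\<ominus> \<one> \<otimes> x = x" for x
        using that False mult_right_cancel[OF minus_one one_closed, of x]
        by (auto simp: one_mult)
    qed (simp add: finite_carrier)
  qed
qed

sublocale abelian_group R
  by (rule abelian_group)

end

subsection \<open>Codes and their number\<close>

context nearfield
begin

text \<open>A code describes an \<open>R\<close>-subgroup of \<open>R\<^sup>n\<close> by one equation \<open>t\<^sub>i = c t\<^sub>m\<close> for each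
  coordinate \<open>i\<close>, where \<open>(m, c)\<close> is the value of the code at \<open>i\<close>: \<open>(i, 0)\<close> says that the coordinate
  vanishes on the subgroup, \<open>(i, 1)\<close> imposes no condition and marks \<open>i\<close> as the least element of the
  support of one of the generators, and any other value ties \<open>i\<close> to such a pivot \<open>m < i\<close>.\<close>

definition pivots :: "nat \<Rightarrow> (nat \<Rightarrow> nat \<times> 'a) \<Rightarrow> nat set" where
  "pivots n e = {i \<in> {1..n}. e i = (i, \<one>)}"

definition codes :: "nat \<Rightarrow> nat \<Rightarrow> (nat \<Rightarrow> nat \<times> 'a) set" where
  "codes n l = {e \<in> extensional {1..n}. card (pivots n e) = l \<and>
     (\<forall>i\<in>{1..n}. e i = (i, \<zero>) \<or> e i = (i, \<one>) \<or>
        (\<exists>m\<in>pivots n e. \<exists>c\<in>carrier R - {\<zero>}. m < i \<and> e i = (m, c)))}"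

lemma finite_pivots: "finite (pivots n e)"
  by (simp add: pivots_def)

lemma pivots_upd:
  "pivots (Suc n) (e(Suc n := x)) = pivots n e \<union> (if x = (Suc n, \<one>) then {Suc n} else {})"
  by (auto simp: pivots_def)

lemma codes_0: "codes 0 l = (if l = 0 then {\<lambda>_. undefined} else {})"
  by (auto simp: codes_def pivots_def)

lemma codes_updI:
  assumes e: "e \<in> codes n k"
    and x: "x = (Suc n, \<zero>) \<or> x = (Suc n, \<one>) \<or> x \<in> pivots n e \<times> (carrier R - {\<zero>})"
    and l: "l = k + (if x = (Suc n, \<one>) then 1 else 0)"
  shows "e(Suc n := x) \<in> codes (Suc n) l"
proof -
  let ?f = "e(Suc n := x)"
  have "Suc n \<notin> pivots n e"
    by (simp add: pivots_def)
  then have card: "card (pivots (Suc n) ?f) = l"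
    using e by (simp add: pivots_upd l finite_pivots codes_def)
  have sub: "pivots n e \<subseteq> pivots (Suc n) ?f" and less: "m < Suc n" if "m \<in> pivots n e" for m
    using that by (auto simp: pivots_def)
  have ext: "?f \<in> extensional {1..Suc n}"
    using e by (auto simp: codes_def extensional_def)
  have "?f i = (i, \<zero>) \<or> ?f i = (i, \<one>) \<or>
      (\<exists>m\<in>pivots (Suc n) ?f. \<exists>c\<in>carrier R - {\<zero>}. m < i \<and> ?f i = (m, c))"
    if i: "i \<in> {1..Suc n}" for i
  proof (cases "i = Suc n")
    case True
    then show ?thesis
      using x sub less by fastforce
  next
    case False
    then have "e i = (i, \<zero>) \<or> e i = (i, \<one>) \<or>
        (\<exists>m\<in>pivots n e. \<exists>c\<in>carrier R - {\<zero>}. m < i \<and> e i = (m, c))"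
      using e i by (simp add: codes_def)
    then show ?thesis
      using False sub by auto
  qed
  with card ext show ?thesis
    by (simp add: codes_def)
qed

text \<open>An entry refers only to pivots below its own coordinate, so no earlier entry depends on
  the last one, and deleting it leaves a code. The entry is reset to \<open>undefined\<close> to
  restore extensionality.\<close>

lemma codes_updE:
  assumes f: "f \<in> codes (Suc n) l"
  obtains e x k where "f = e(Suc n := x)" "e \<in> codes n k"
    "x = (Suc n, \<zero>) \<or> x = (Suc n, \<one>) \<or> x \<in> pivots n e \<times> (carrier R - {\<zero>})"
    "l = k + (if x = (Suc n, \<one>) then 1 else 0)"
proof
  define e where "e = f(Suc n := undefined)"
  show f_eq: "f = e(Suc n := f (Suc n))"
    by (simp add: e_def)
  have piv: "m \<in> pivots n e \<longleftrightarrow> m \<in> pivots (Suc n) f \<and> m < Suc n" for m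
    by (auto simp: pivots_def e_def)
  have cases: "f i = (i, \<zero>) \<or> f i = (i, \<one>) \<or>
      (\<exists>m\<in>pivots (Suc n) f. \<exists>c\<in>carrier R - {\<zero>}. m < i \<and> f i = (m, c))"
    if "i \<in> {1..Suc n}" for i
    using f that by (simp add: codes_def)
  have "e i = (i, \<zero>) \<or> e i = (i, \<one>) \<or>
      (\<exists>m\<in>pivots n e. \<exists>c\<in>carrier R - {\<zero>}. m < i \<and> e i = (m, c))"
    if "i \<in> {1..n}" for i
    using cases[of i] that by (fastforce simp: e_def piv[unfolded e_def])
  moreover have "e \<in> extensional {1..n}"
    using f by (auto simp: e_def codes_def extensional_def)
  ultimately show "e \<in> codes n (card (pivots n e))"
    by (simp add: codes_def)
  show "f (Suc n) = (Suc n, \<zero>) \<or> f (Suc n) = (Suc n, \<one>) \<or>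
      f (Suc n) \<in> pivots n e \<times> (carrier R - {\<zero>})"
    using cases[of "Suc n"] piv by fastforce
  have "Suc n \<notin> pivots n e"
    by (simp add: pivots_def)
  moreover have "l = card (pivots (Suc n) (e(Suc n := f (Suc n))))"
    using f f_eq by (simp add: codes_def)
  ultimately show "l = card (pivots n e) + (if f (Suc n) = (Suc n, \<one>) then 1 else 0)"
    by (simp add: pivots_upd finite_pivots)
qed

text \<open>The union over \<open>{k. l = Suc k}\<close> has one member for positive
  \<open>l\<close> and none for \<open>l = 0\<close>; this avoids a truncated \<open>l - 1\<close>
  when the new coordinate is a pivot.\<close>

lemma codes_Suc:
  "codes (Suc n) l = (\<lambda>(e, x). e(Suc n := x)) `
     ((SIGMA e : codes n l. insert (Suc n, \<zero>) (pivots n e \<times> (carrier R - {\<zero>}))) \<union>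
      (\<Union>k\<in>{k. l = Suc k}. codes n k \<times> {(Suc n, \<one>)}))" (is "_ = ?upd ` ?P")
proof (intro equalityI subsetI)
  fix f assume "f \<in> codes (Suc n) l"
  then obtain e x k where "f = e(Suc n := x)" "e \<in> codes n k"
    "x = (Suc n, \<zero>) \<or> x = (Suc n, \<one>) \<or> x \<in> pivots n e \<times> (carrier R - {\<zero>})"
    "l = k + (if x = (Suc n, \<one>) then 1 else 0)"
    by (rule codes_updE)
  then have "f = ?upd (e, x)" "(e, x) \<in> ?P"
    using one_not_zero by (auto split: if_splits)
  then show "f \<in> ?upd ` ?P"
    by blast
next
  fix f assume "f \<in> ?upd ` ?P"
  moreover have "x \<noteq> (Suc n, \<one>)" if "x \<in> pivots n e \<times> (carrier R - {\<zero>})" for x e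
    using that by (auto simp: pivots_def)
  ultimately show "f \<in> codes (Suc n) l"
    using one_not_zero by (auto intro!: codes_updI)
qed

text \<open>Codes are undefined at \<open>Suc n\<close>, so overwriting that entry loses nothing.
  The union over \<open>l\<close> is needed because codes with different numbers of pivots are
  extended to codes with the same number.\<close>

lemma inj_on_upd_codes: "inj_on (\<lambda>(e, x). e(Suc n := x)) ((\<Union>l. codes n l) \<times> UNIV)"
proof (rule inj_onI, clarify)
  fix e x e' x' l l'
  assume codes: "e \<in> codes n l" "e' \<in> codes n l'" and eq: "e(Suc n := x) = e'(Suc n := x')"
  have "e (Suc n) = e' (Suc n)"
    using codes by (simp add: codes_def extensional_def)
  then show "e = e' \<and> x = x'"
    using eq by (metis fun_upd_eqD fun_upd_triv fun_upd_upd)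
qed

end

context finite_nearfield
begin

lemma finite_codes: "finite (codes n l)"
proof (induction n arbitrary: l)
  case 0
  then show ?case by (simp add: codes_0)
next
  case (Suc n)
  have "finite (\<Union>k\<in>{k. l = Suc k}. codes n k \<times> {(Suc n, \<one>)})"
    by (cases l) (simp_all add: Suc)
  then show ?case
    by (simp add: codes_Suc Suc finite_pivots finite_carrier)
qed

lemma card_codes_Suc:
  "card (codes (Suc n) l) = (1 + l * (card (carrier R) - 1)) * card (codes n l) +
     (if l = 0 then 0 else card (codes n (l - 1)))"
proof -
  let ?A = "SIGMA e : codes n l. insert (Suc n, \<zero>) (pivots n e \<times> (carrier R - {\<zero>}))"
  let ?B = "\<Union>k\<in>{k. l = Suc k}. codes n k \<times> {(Suc n, \<one>)}"
  have "card (insert (Suc n, \<zero>) (pivots n e \<times> (carrier R - {\<zero>}))) =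
      1 + l * (card (carrier R) - 1)" if "e \<in> codes n l" for e
    using that finite_carrier
    by (simp add: card_cartesian_product finite_pivots codes_def card_Diff_singleton)
  then have "(\<Sum>e\<in>codes n l. card (insert (Suc n, \<zero>) (pivots n e \<times> (carrier R - {\<zero>})))) =
      (\<Sum>e\<in>codes n l. 1 + l * (card (carrier R) - 1))"
    by (rule sum.cong[OF refl])
  then have A: "card ?A = (1 + l * (card (carrier R) - 1)) * card (codes n l)"
    by (subst card_SigmaI) (simp_all add: finite_codes finite_pivots finite_carrier)
  have B: "card ?B = (if l = 0 then 0 else card (codes n (l - 1)))" and finB: "finite ?B"
    by (cases l; simp add: finite_codes card_cartesian_product)+
  have finA: "finite ?A"
    by (simp add: finite_codes finite_pivots finite_carrier)
  \<comment> \<open>The appended value \<open>(Suc n, \<one>)\<close> differs from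
    \<open>(Suc n, \<zero>)\<close>, and pivots of \<open>e\<close> are at most
    \<open>n\<close>.\<close>
  have disj: "?A \<inter> ?B = {}"
    using one_not_zero by (auto simp: pivots_def)
  have "?A \<union> ?B \<subseteq> (\<Union>l. codes n l) \<times> UNIV"
    by auto
  then have "card (codes (Suc n) l) = card (?A \<union> ?B)"
    unfolding codes_Suc by (intro card_image inj_on_subset[OF inj_on_upd_codes])
  also have "\<dots> = card ?A + card ?B"
    using finA finB disj by (rule card_Un_disjoint)
  finally show ?thesis
    by (simp only: A B)
qed

end

section \<open>The binomial-Stirling sum and its recurrence\<close>

text \<open>Pascal's rule after an index shift; the additional term of the first sum vanishes
  because \<open>n choose Suc n\<close> is zero.\<close>

lemma sum_binomial_Suc:
  fixes g :: "nat \<Rightarrow> nat"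
  shows "(\<Sum>k\<le>Suc n. (Suc n choose k) * g k) =
    (\<Sum>k\<le>n. (n choose k) * g k) + (\<Sum>k\<le>n. (n choose k) * g (Suc k))"
proof -
  have "(\<Sum>k\<le>n. (n choose k) * g k) = (\<Sum>k\<le>Suc n. (n choose k) * g k)"
    by simp
  also have "\<dots> = g 0 + (\<Sum>k\<le>n. (n choose Suc k) * g (Suc k))"
    by (subst sum.atMost_Suc_shift) simp
  finally show ?thesis
    by (subst sum.atMost_Suc_shift) (simp add: sum.distrib distrib_right)
qed

text \<open>The truncated exponents are harmless because \<open>Stirling k l = 0\<close> for \<open>k < l\<close>.\<close>

lemma sum_binomial_Stirling_Suc:
  fixes q :: nat
  defines "f \<equiv> \<lambda>n l. \<Sum>k\<le>n. (n choose k) * (Stirling k l * q ^ (k - l))"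
  shows "f (Suc n) l = (1 + l * q) * f n l + (if l = 0 then 0 else f n (l - 1))"
proof -
  \<comment> \<open>The Stirling recurrence splits the term. The exponent is one more than
    \<open>k - l\<close>, whence the factor \<open>q\<close>, and for positive \<open>l\<close> it
    equals \<open>k - (l - 1)\<close>.\<close>
  have step: "Stirling (Suc k) l * q ^ (Suc k - l) =
      l * q * (Stirling k l * q ^ (k - l)) +
      (if l = 0 then 0 else Stirling k (l - 1) * q ^ (k - (l - 1)))" for k
  proof (cases l)
    case (Suc l')
    show ?thesis
    proof (cases "l \<le> k")
      case True
      then have "k - l' = Suc (k - l)"
        using Suc by simp
      then show ?thesis
        by (simp add: Suc algebra_simps)
    qed (simp add: Suc)
  qed simp
  have "f (Suc n) l = f n l + (\<Sum>k\<le>n. (n choose k) * (Stirling (Suc k) l * q ^ (Suc k - l)))"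
    unfolding f_def by (rule sum_binomial_Suc)
  also have "(\<Sum>k\<le>n. (n choose k) * (Stirling (Suc k) l * q ^ (Suc k - l))) =
      l * q * f n l + (if l = 0 then 0 else f n (l - 1))"
    unfolding step f_def
    by (simp add: distrib_left sum.distrib sum_distrib_left mult.left_commute)
  finally show ?thesis
    by (simp add: algebra_simps)
qed

text \<open>The induction uses the sum over all \<open>k = n - d\<close> up to \<open>n\<close>,
  whose range is independent of \<open>l\<close>, so that the two recurrences match literally. The
  zero terms with \<open>k < l\<close> are dropped only afterwards.\<close>

lemma (in finite_nearfield) card_codes:
  "card (codes n l) =
     (\<Sum>d | d + l \<le> n. (n choose d) * Stirling (n - d) l * (card (carrier R) - 1) ^ (n - d - l))"
proof -
  let ?q = "card (carrier R) - 1"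
  have "card (codes n l) = (\<Sum>k\<le>n. (n choose k) * (Stirling k l * ?q ^ (k - l)))"
  proof (induction n arbitrary: l)
    case 0
    then show ?case by (cases l) (simp_all add: codes_0)
  next
    case (Suc n)
    then show ?case
      by (simp only: card_codes_Suc sum_binomial_Stirling_Suc)
  qed
  also have "\<dots> = (\<Sum>k\<in>{l..n}. (n choose k) * (Stirling k l * ?q ^ (k - l)))"
    by (rule sum.mono_neutral_right) auto
  also have "\<dots> = (\<Sum>d | d + l \<le> n. (n choose d) * Stirling (n - d) l * ?q ^ (n - d - l))"
    by (rule sum.reindex_bij_witness[of _ "\<lambda>d. n - d" "\<lambda>k. n - k"])
       (auto simp: binomial_symmetric[symmetric] mult.assoc)
  finally show ?thesis .
qed

subsection \<open>Vectors and subgroups of vectors\<close>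

context finite_nearfield
begin

lemma carrier_vec_group: "carrier (vec_group R n) = ({1..n} \<rightarrow>\<^sub>E carrier R)"
  and one_vec_group: "\<one>\<^bsub>vec_group R n\<^esub> = (\<lambda>i\<in>{1..n}. \<zero>)"
  and mult_vec_group: "v \<otimes>\<^bsub>vec_group R n\<^esub> w = (\<lambda>i\<in>{1..n}. v i \<oplus> w i)"
  by (simp_all add: vec_group_def)

lemma comm_group_vec_group: "comm_group (vec_group R n)"
proof (rule group.group_comm_groupI)
  show "group (vec_group R n)"
    by (simp add: vec_group_def add_group)
  show "v \<otimes>\<^bsub>vec_group R n\<^esub> w = w \<otimes>\<^bsub>vec_group R n\<^esub> v"
    if "v \<in> carrier (vec_group R n)" "w \<in> carrier (vec_group R n)" for v w
    using that by (auto simp: carrier_vec_group mult_vec_group a_comm PiE_iff intro!: restrict_ext)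
qed

lemma inv_vec_group:
  assumes "v \<in> carrier (vec_group R n)"
  shows "inv\<^bsub>vec_group R n\<^esub> v = scalar_mult R n v (\<ominus> \<one>)"
proof -
  have "inv\<^bsub>vec_group R n\<^esub> v = (\<lambda>i\<in>{1..n}. \<ominus> v i)"
    using assms add_group by (simp add: vec_group_def a_inv_def)
  also have "\<dots> = scalar_mult R n v (\<ominus> \<one>)"
    unfolding scalar_mult_def using assms
    by (intro restrict_ext) (simp add: carrier_vec_group PiE_iff mult_minus mult_one one_closed)
  finally show ?thesis .
qed

text \<open>Scalar multiplication by \<open>\<ominus> \<one>\<close> is negation, so closure under
  inverses comes for free.\<close>

lemma R_subgroup_iff:
  "R_subgroup R n H \<longleftrightarrow> H \<subseteq> ({1..n} \<rightarrow>\<^sub>E carrier R) \<and> H \<noteq> {} \<and>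
     (\<forall>v\<in>H. \<forall>w\<in>H. (\<lambda>i\<in>{1..n}. v i \<oplus> w i) \<in> H) \<and>
     (\<forall>v\<in>H. \<forall>r\<in>carrier R. scalar_mult R n v r \<in> H)" (is "_ \<longleftrightarrow> ?rhs")
proof
  assume "R_subgroup R n H"
  then have "subgroup H (vec_group R n)" "\<forall>v\<in>H. \<forall>r\<in>carrier R. scalar_mult R n v r \<in> H"
    by (simp_all add: R_subgroup_def)
  then show ?rhs
    using subgroup.m_closed[of H "vec_group R n"] subgroup.subset[of H "vec_group R n"]
      subgroup.one_closed[of H "vec_group R n"]
    unfolding carrier_vec_group mult_vec_group by blast
next
  assume H: ?rhs
  interpret V: comm_group "vec_group R n" by (rule comm_group_vec_group)
  have "subgroup H (vec_group R n)"
  proof (rule V.subgroupI)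
    show "inv\<^bsub>vec_group R n\<^esub> v \<in> H" if "v \<in> H" for v
      using that H by (subst inv_vec_group) (auto simp: carrier_vec_group one_closed)
  qed (use H in \<open>simp_all add: carrier_vec_group mult_vec_group\<close>)
  with H show "R_subgroup R n H"
    by (simp add: R_subgroup_def)
qed

lemma R_subgroup_closed:
  assumes "R_subgroup R n H" "v \<in> H" "i \<in> {1..n}"
  shows "v i \<in> carrier R"
  using assms by (auto simp: R_subgroup_iff PiE_iff)

lemma R_subgroup_combination:
  assumes "R_subgroup R n H" "v \<in> H" "w \<in> H" "r \<in> carrier R" "s \<in> carrier R"
  shows "(\<lambda>i\<in>{1..n}. v i \<otimes> r \<oplus> w i \<otimes> s) \<in> H"
proof -
  have "(\<lambda>i\<in>{1..n}. scalar_mult R n v r i \<oplus> scalar_mult R n w s i) \<in> H"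
    using assms unfolding R_subgroup_iff by blast
  then show ?thesis
    by (simp add: scalar_mult_def cong: restrict_cong)
qed

text \<open>The elimination step for clearing a coordinate: scaling \<open>w\<close> by
  \<open>\<ominus> s\<close> negates its multiple by \<open>s\<close>, since left multiplication
  commutes with negation.\<close>

lemma R_subgroup_diff:
  assumes "R_subgroup R n H" "v \<in> H" "w \<in> H" "s \<in> carrier R"
  shows "(\<lambda>i\<in>{1..n}. v i \<ominus> w i \<otimes> s) \<in> H"
proof -
  have "(\<lambda>i\<in>{1..n}. v i \<otimes> \<one> \<oplus> w i \<otimes> (\<ominus> s)) \<in> H"
    using assms by (intro R_subgroup_combination) (auto simp: one_closed)
  also have "(\<lambda>i\<in>{1..n}. v i \<otimes> \<one> \<oplus> w i \<otimes> (\<ominus> s)) = (\<lambda>i\<in>{1..n}. v i \<ominus> w i \<otimes> s)"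
    using assms R_subgroup_closed[OF assms(1)]
    by (intro restrict_ext) (simp add: mult_one mult_minus a_minus_def)
  finally show ?thesis .
qed

lemma R_subgroup_zero:
  assumes "R_subgroup R n H"
  shows "(\<lambda>i\<in>{1..n}. \<zero>) \<in> H"
  using subgroup.one_closed[of H "vec_group R n"] assms
  by (simp add: R_subgroup_def one_vec_group)

text \<open>Left distributivity and associativity, applied in each coordinate, turn sums and
  multiples of multiples of \<open>u\<close> into multiples of \<open>u\<close>.\<close>

lemma R_subgroup_multiples:
  assumes u: "u \<in> {1..n} \<rightarrow>\<^sub>E carrier R"
  shows "R_subgroup R n (multiples R n u)"
  unfolding R_subgroup_iff
proof (intro conjI ballI)
  show "multiples R n u \<subseteq> {1..n} \<rightarrow>\<^sub>E carrier R"
    using u by (auto simp: multiples_def scalar_mult_def m_closed PiE_iff)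
  show "multiples R n u \<noteq> {}"
    using one_closed by (auto simp: multiples_def)
  fix v assume "v \<in> multiples R n u"
  then obtain r where r: "r \<in> carrier R" "v = scalar_mult R n u r"
    by (auto simp: multiples_def)
  have "(\<lambda>i\<in>{1..n}. v i \<oplus> scalar_mult R n u s i) = scalar_mult R n u (r \<oplus> s)"
    if "s \<in> carrier R" for s
    unfolding r scalar_mult_def using u r that
    by (intro restrict_ext) (simp add: distrib_left PiE_iff)
  then show "(\<lambda>i\<in>{1..n}. v i \<oplus> w i) \<in> multiples R n u" if "w \<in> multiples R n u" for w
    using that r by (auto simp: multiples_def)
  have "scalar_mult R n v s = scalar_mult R n u (r \<otimes> s)" if "s \<in> carrier R" for s
    unfolding r scalar_mult_def using u r that
    by (intro restrict_ext) (simp add: m_assoc PiE_iff)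
  then show "scalar_mult R n v s \<in> multiples R n u" if "s \<in> carrier R" for s
    using that r by (auto simp: multiples_def m_closed)
qed

lemma R_subgroup_normalize:
  assumes T: "R_subgroup R n T" and "t \<in> T" "i \<in> {1..n}" "t i \<noteq> \<zero>"
  obtains w where "w \<in> T" "w i = \<one>" "\<And>j. \<lbrakk>j \<in> {1..n}; t j = \<zero>\<rbrakk> \<Longrightarrow> w j = \<zero>"
proof -
  obtain s where "s \<in> carrier R" "t i \<otimes> s = \<one>"
    using assms by (metis R_subgroup_closed inverse_exists)
  then show thesis
    using T \<open>t \<in> T\<close> \<open>i \<in> {1..n}\<close> unfolding R_subgroup_iff
    by (intro that[of "scalar_mult R n t s"]) (auto simp: scalar_mult_def zero_mult)
qed

lemma finprod_vec_group:
  assumes "finite J" "i \<in> {1..n}" "x \<in> J \<rightarrow> carrier (vec_group R n)"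
  shows "finprod (vec_group R n) x J i = (\<Oplus>j\<in>J. x j i)"
proof -
  interpret V: comm_group "vec_group R n" by (rule comm_group_vec_group)
  show ?thesis
    using assms
  proof (induction J)
    case empty
    then show ?case by (simp add: one_vec_group)
  next
    case (insert j J)
    moreover have "x k i \<in> carrier R" if "k \<in> insert j J" for k
      using insert.prems that by (auto simp: carrier_vec_group PiE_iff Pi_iff)
    ultimately show ?case
      by (simp add: mult_vec_group Pi_iff)
  qed
qed

lemma finprod_R_subgroup:
  assumes "R_subgroup R n T" "finite J" "x \<in> J \<rightarrow> T"
  shows "finprod (vec_group R n) x J \<in> T"
proof -
  interpret V: comm_group "vec_group R n" by (rule comm_group_vec_group)
  have T: "subgroup T (vec_group R n)"
    using assms by (simp add: R_subgroup_def)
  show ?thesis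
    using assms(2,3)
  proof (induction J)
    case empty
    then show ?case by (simp add: subgroup.one_closed[OF T])
  next
    case (insert j J)
    then have "x \<in> insert j J \<rightarrow> carrier (vec_group R n)"
      using subgroup.subset[OF T] by blast
    with insert show ?case
      by (simp add: subgroup.m_closed[OF T] Pi_iff)
  qed
qed

section \<open>Cardinality and uniqueness of the dimension\<close>

lemma card_multiples:
  assumes "u \<in> carrier (vec_group R n)" "u \<noteq> \<one>\<^bsub>vec_group R n\<^esub>"
  shows "card (multiples R n u) = card (carrier R)"
proof -
  obtain i where i: "i \<in> {1..n}" "u i \<noteq> \<zero>"
    using assms by (force simp: carrier_vec_group one_vec_group PiE_iff extensional_def)
  have "inj_on (scalar_mult R n u) (carrier R)"
  proof (rule inj_onI)
    fix r s assume rs: "r \<in> carrier R" "s \<in> carrier R"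
    assume "scalar_mult R n u r = scalar_mult R n u s"
    then have "scalar_mult R n u r i = scalar_mult R n u s i"
      by simp
    then show "r = s"
      using i assms rs mult_left_cancel[of r s "u i"]
      by (auto simp: scalar_mult_def carrier_vec_group PiE_iff)
  qed
  moreover have "multiples R n u = scalar_mult R n u ` carrier R"
    by (auto simp: multiples_def)
  ultimately show ?thesis
    by (simp add: card_image)
qed

lemma card_has_disjoint_decomposition:
  assumes "has_disjoint_decomposition R n T l"
  shows "card T = card (carrier R) ^ l"
proof -
  obtain u where u: "\<forall>j\<in>{1..l}. u j \<in> carrier (vec_group R n) \<and> u j \<noteq> \<one>\<^bsub>vec_group R n\<^esub>"
    and bij: "bij_betw (\<lambda>x. finprod (vec_group R n) x {1..l}) (\<Pi>\<^sub>E j\<in>{1..l}. multiples R n (u j)) T"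
    using assms by (auto simp: has_disjoint_decomposition_def internal_direct_sum_def)
  have "card T = card (\<Pi>\<^sub>E j\<in>{1..l}. multiples R n (u j))"
    using bij by (simp add: bij_betw_same_card)
  also have "\<dots> = (\<Prod>j\<in>{1..l}. card (multiples R n (u j)))"
    by (simp add: card_PiE)
  also have "\<dots> = (\<Prod>j\<in>{1..l}. card (carrier R))"
    using u by (intro prod.cong) (auto simp: card_multiples)
  finally show ?thesis by simp
qed

lemma dimension_eqI:
  assumes "has_disjoint_decomposition R n T l"
  shows "dimension R n T = l"
  unfolding dimension_def
proof (rule the_equality)
  fix k assume "has_disjoint_decomposition R n T k"
  then have "card (carrier R) ^ k = card (carrier R) ^ l"
    using assms card_has_disjoint_decomposition by metis
  \<comment> \<open>The base of the powers is at least two, so the exponent is determined.\<close>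
  moreover have "card {\<zero>, \<one>} \<le> card (carrier R)"
    by (intro card_mono finite_carrier) (simp add: one_closed)
  ultimately show "k = l"
    using one_not_zero by (simp add: power_inject_exp)
qed (rule assms)

end

subsection \<open>From codes to subgroups\<close>

context finite_nearfield
begin

definition decode :: "nat \<Rightarrow> (nat \<Rightarrow> nat \<times> 'a) \<Rightarrow> (nat \<Rightarrow> 'a) set" where
  "decode n e = {t \<in> {1..n} \<rightarrow>\<^sub>E carrier R. \<forall>i\<in>{1..n}. t i = snd (e i) \<otimes> t (fst (e i))}"

text \<open>For a code \<open>e\<close> and a pivot \<open>m\<close>, this is the only element of
  \<open>decode n e\<close> with entry one at \<open>m\<close> and zero at the other pivots. Entries
  point directly to pivots, so no chain of factors has to be multiplied.\<close>

definition generator :: "nat \<Rightarrow> (nat \<Rightarrow> nat \<times> 'a) \<Rightarrow> nat \<Rightarrow> (nat \<Rightarrow> 'a)" where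
  "generator n e m = (\<lambda>i\<in>{1..n}. if fst (e i) = m then snd (e i) else \<zero>)"

lemma codes_cases:
  assumes "e \<in> codes n l" "i \<in> {1..n}"
  obtains "e i = (i, \<zero>)" | "e i = (i, \<one>)" "i \<in> pivots n e"
    | m c where "m \<in> pivots n e" "c \<in> carrier R" "c \<noteq> \<zero>" "m < i" "e i = (m, c)"
  using assms unfolding codes_def pivots_def by blast

lemma pivotsD:
  assumes "m \<in> pivots n e"
  shows "m \<in> {1..n}" "e m = (m, \<one>)"
  using assms by (auto simp: pivots_def)

lemma codes_closed:
  assumes "e \<in> codes n l" "i \<in> {1..n}"
  shows "fst (e i) \<in> {1..n}" "snd (e i) \<in> carrier R"
  using assms by (cases rule: codes_cases; auto simp: one_closed dest: pivotsD)+

text \<open>The factors of a code multiply from the left and scalars act from the right: left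
  distributivity preserves the equations under sums, associativity under scalars.\<close>

lemma R_subgroup_decode:
  assumes e: "e \<in> codes n l"
  shows "R_subgroup R n (decode n e)"
  unfolding R_subgroup_iff
proof (intro conjI ballI)
  have closed: "t i \<in> carrier R" if "t \<in> decode n e" "i \<in> {1..n}" for t i
    using that by (auto simp: decode_def PiE_iff)
  have eq: "t i = snd (e i) \<otimes> t (fst (e i))" if "t \<in> decode n e" "i \<in> {1..n}" for t i
    using that by (auto simp: decode_def)
  show "decode n e \<subseteq> {1..n} \<rightarrow>\<^sub>E carrier R"
    by (auto simp: decode_def)
  have "(\<lambda>i\<in>{1..n}. \<zero>) \<in> decode n e"
    using codes_closed[OF e] by (auto simp: decode_def mult_zero)
  then show "decode n e \<noteq> {}"
    by blast
  fix v assume v: "v \<in> decode n e"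
  show "(\<lambda>i\<in>{1..n}. v i \<oplus> w i) \<in> decode n e" if w: "w \<in> decode n e" for w
  proof -
    have "snd (e i) \<otimes> (v (fst (e i)) \<oplus> w (fst (e i))) = v i \<oplus> w i" if "i \<in> {1..n}" for i
      using codes_closed[OF e that] closed[OF v] closed[OF w] eq[OF v that] eq[OF w that]
      by (simp add: distrib_left)
    then show ?thesis
      using codes_closed(1)[OF e] closed[OF v] closed[OF w] by (simp add: decode_def)
  qed
  show "scalar_mult R n v r \<in> decode n e" if r: "r \<in> carrier R" for r
  proof -
    have "snd (e i) \<otimes> (v (fst (e i)) \<otimes> r) = v i \<otimes> r" if "i \<in> {1..n}" for i
      using codes_closed[OF e that] closed[OF v] eq[OF v that] r
      by (simp add: m_assoc[symmetric])
    then show ?thesis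
      using codes_closed(1)[OF e] closed[OF v] r
      by (simp add: decode_def scalar_mult_def m_closed)
  qed
qed

lemma generator_pivot:
  assumes "m \<in> pivots n e" "k \<in> pivots n e"
  shows "generator n e m k = (if k = m then \<one> else \<zero>)"
  using pivotsD[OF assms(1)] pivotsD[OF assms(2)] by (simp add: generator_def)

lemma generator_in_decode:
  assumes e: "e \<in> codes n l" and m: "m \<in> pivots n e"
  shows "generator n e m \<in> decode n e"
proof -
  have "generator n e m i = snd (e i) \<otimes> generator n e m (fst (e i))" if i: "i \<in> {1..n}" for i
    using e i
  proof (cases rule: codes_cases)
    case 1
    then have "generator n e m i = \<zero>"
      using i by (auto simp: generator_def)
    with 1 show ?thesis
      by (simp add: zero_mult)
  next
    case 2
    then show ?thesis
      using generator_pivot[OF m] by (simp add: one_mult one_closed)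
  next
    case (3 k c)
    then have "generator n e m i = (if k = m then c else \<zero>)"
      using i by (simp add: generator_def)
    then show ?thesis
      using 3 generator_pivot[OF m, of k] by (simp add: mult_one mult_zero)
  qed
  moreover have "generator n e m \<in> {1..n} \<rightarrow>\<^sub>E carrier R"
    using codes_closed[OF e] by (auto simp: generator_def)
  ultimately show ?thesis
    by (simp add: decode_def)
qed

text \<open>Each entry of a solution is zero, a pivot entry, or a left multiple of a pivot
  entry.\<close>

lemma decode_eqI:
  assumes e: "e \<in> codes n l" and t: "s \<in> decode n e" "t \<in> decode n e"
    and eq: "\<And>m. m \<in> pivots n e \<Longrightarrow> s m = t m"
  shows "s = t"
proof (rule PiE_ext)
  show vec: "s \<in> {1..n} \<rightarrow>\<^sub>E carrier R" "t \<in> {1..n} \<rightarrow>\<^sub>E carrier R"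
    using t by (auto simp: decode_def)
  fix i assume i: "i \<in> {1..n}"
  have s: "s i = snd (e i) \<otimes> s (fst (e i))" and t: "t i = snd (e i) \<otimes> t (fst (e i))"
    using t i by (auto simp: decode_def)
  show "s i = t i"
    using e i
  proof (cases rule: codes_cases)
    case 1
    then show ?thesis
      using s t PiE_mem[OF vec(1) i] PiE_mem[OF vec(2) i] by (metis fst_conv snd_conv zero_mult)
  next
    case 2
    then show ?thesis
      by (simp add: eq)
  next
    case (3 m c)
    then show ?thesis
      unfolding s t by (simp add: eq)
  qed
qed

text \<open>This recovers the pivots from the subgroup alone, as the possible leading positions. A
  generator leads at its pivot because tied coordinates lie above it; at a non-pivot an entry is
  zero or a multiple of an earlier entry, so no vector leads there.\<close>

lemma pivots_decode:
  assumes e: "e \<in> codes n l"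
  shows "pivots n e =
    {i \<in> {1..n}. \<exists>t\<in>decode n e. t i \<noteq> \<zero> \<and> (\<forall>j\<in>{1..n}. j < i \<longrightarrow> t j = \<zero>)}"
proof (intro equalityI subsetI)
  fix i assume i: "i \<in> pivots n e"
  have "generator n e i j = \<zero>" if "j \<in> {1..n}" "j < i" for j
    using e that(1)
  proof (cases rule: codes_cases)
  qed (use that in \<open>auto simp: generator_def\<close>)
  moreover have "generator n e i i \<noteq> \<zero>"
    using generator_pivot[OF i i] one_not_zero by simp
  ultimately show "i \<in> {i \<in> {1..n}. \<exists>t\<in>decode n e. t i \<noteq> \<zero> \<and> (\<forall>j\<in>{1..n}. j < i \<longrightarrow> t j = \<zero>)}"
    using generator_in_decode[OF e i] pivotsD(1)[OF i] by blast
next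
  fix i assume "i \<in> {i \<in> {1..n}. \<exists>t\<in>decode n e. t i \<noteq> \<zero> \<and> (\<forall>j\<in>{1..n}. j < i \<longrightarrow> t j = \<zero>)}"
  then obtain t where i: "i \<in> {1..n}" and t: "t \<in> decode n e" "t i \<noteq> \<zero>"
    and less: "\<And>j. j \<in> {1..n} \<Longrightarrow> j < i \<Longrightarrow> t j = \<zero>"
    by auto
  have ti: "snd (e i) \<otimes> t (fst (e i)) = t i"
    using t i by (simp add: decode_def)
  have closed: "t i \<in> carrier R"
    by (rule R_subgroup_closed[OF R_subgroup_decode[OF e] t(1) i])
  show "i \<in> pivots n e"
    using e i
  proof (cases rule: codes_cases)
    case 1
    then have "t i = \<zero> \<otimes> t i"
      using ti by simp
    then show ?thesis
      using zero_mult[OF closed] t(2) by metis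
  next
    case (3 m c)
    then have "t i = c \<otimes> t m"
      using ti by simp
    also have "\<dots> = \<zero>"
      using 3 less[OF pivotsD(1)] by (simp add: mult_zero)
    finally show ?thesis
      using t(2) by contradiction
  qed
qed

text \<open>Equal subgroups have equal pivots, and the entries of the generators then reveal all
  remaining values of the code.\<close>

lemma inj_on_decode: "inj_on (decode n) (\<Union>l. codes n l)"
proof (rule inj_onI, clarify)
  fix e e' l l' assume e: "e \<in> codes n l" and e': "e' \<in> codes n l'"
    and eq: "decode n e = decode n e'"
  have piv: "pivots n e = pivots n e'"
    unfolding pivots_decode[OF e] pivots_decode[OF e'] eq ..
  \<comment> \<open>The generator of \<open>m\<close> for \<open>e\<close> has the nonzero entry
    \<open>c\<close> at \<open>i\<close> and also solves the equations of \<open>e'\<close>. So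
    \<open>e'\<close> can neither make \<open>i\<close> vanish nor tie it to another pivot, and its
    factor must be \<open>c\<close>. The codes are generalized because both directions are
    used.\<close>
  have transfer: "e' i = (m, c)"
    if e: "e \<in> codes n l" and e': "e' \<in> codes n l'" and eq: "decode n e = decode n e'"
      and piv: "pivots n e = pivots n e'" and m: "m \<in> pivots n e" and c: "c \<noteq> \<zero>" "c \<in> carrier R"
      and i: "i \<in> {1..n}" and ei: "e i = (m, c)" for e e' l l' i m c
  proof -
    let ?g = "generator n e m"
    have gi: "?g i = c"
      using i ei by (simp add: generator_def)
    have "?g \<in> decode n e'"
      using generator_in_decode[OF e m] eq by simp
    then have gi': "snd (e' i) \<otimes> ?g (fst (e' i)) = c"
      using i gi by (simp add: decode_def)
    have piv_g: "?g k = (if k = m then \<one> else \<zero>)" if "k \<in> pivots n e'" for k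
      using generator_pivot[OF m] that piv by simp
    show ?thesis
      using e' i
    proof (cases rule: codes_cases)
      case 1
      then show ?thesis using gi gi' c by (simp add: zero_mult)
    next
      case 2
      then have "i \<in> pivots n e"
        using piv by simp
      then have "e i = (i, \<one>)"
        by (rule pivotsD)
      with 2 show ?thesis using ei by simp
    next
      case (3 k d)
      then show ?thesis
        using gi gi' c piv_g[of k] by (auto simp: mult_one mult_zero split: if_splits)
    qed
  qed
  show "e = e'"
  proof (rule extensionalityI)
    show "e \<in> extensional {1..n}" "e' \<in> extensional {1..n}"
      using e e' by (auto simp: codes_def)
    fix i assume i: "i \<in> {1..n}"
    show "e i = e' i"
      using e i
    proof (cases rule: codes_cases)
      case 1
      show ?thesis
        using e' i
      proof (cases rule: codes_cases)
        case (3 m c)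
        then show ?thesis
          using transfer[OF e' e eq[symmetric] piv[symmetric] _ _ _ i] by simp
      next
        case 2
        then show ?thesis
          using piv pivotsD(2)[of i n e] by simp
      qed (use 1 in simp)
    next
      case 2
      then show ?thesis
        using piv pivotsD(2)[of i n e'] by simp
    next
      case (3 m c)
      then show ?thesis
        using transfer[OF e e' eq piv _ _ _ i] by simp
    qed
  qed
qed

text \<open>The generators of the pivots form the decomposition. Their supports are disjoint because
  each coordinate points to a single pivot, and the coefficient of a generator in \<open>t\<close>
  is the entry of \<open>t\<close> at its pivot.\<close>

lemma has_disjoint_decomposition_decode:
  assumes e: "e \<in> codes n l"
  shows "has_disjoint_decomposition R n (decode n e) l"
proof -
  obtain g where g: "bij_betw g {1..l} (pivots n e)"
    using e ex_bij_betw_nat_finite_1[OF finite_pivots[of n e]] by (auto simp: codes_def)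
  define u where "u j = generator n e (g j)" for j
  have g_piv: "g j \<in> pivots n e" if "j \<in> {1..l}" for j
    using bij_betwE[OF g] that by blast
  have g_eq: "g j = g k \<longleftrightarrow> j = k" if "j \<in> {1..l}" "k \<in> {1..l}" for j k
    using bij_betw_imp_inj_on[OF g] that by (rule inj_on_eq_iff)
  have u_decode: "u j \<in> decode n e" if "j \<in> {1..l}" for j
    unfolding u_def by (rule generator_in_decode[OF e g_piv[OF that]])
  have u_pivot: "u j (g k) = (if j = k then \<one> else \<zero>)" if "j \<in> {1..l}" "k \<in> {1..l}" for j k
    using generator_pivot[OF g_piv[OF that(1)] g_piv[OF that(2)]] g_eq[OF that]
    by (auto simp: u_def)
  have u_vec: "u j \<in> {1..n} \<rightarrow>\<^sub>E carrier R" if "j \<in> {1..l}" for j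
    using u_decode[OF that] by (simp add: decode_def)
  have mult_pivot: "scalar_mult R n (u j) r (g k) = (if j = k then r else \<zero>)"
    if "j \<in> {1..l}" "k \<in> {1..l}" "r \<in> carrier R" for j k r
    using that u_pivot pivotsD(1)[OF g_piv] by (simp add: scalar_mult_def one_mult zero_mult)
  have sub: "R_subgroup R n (multiples R n (u j))" if "j \<in> {1..l}" for j
    by (rule R_subgroup_multiples[OF u_vec[OF that]])
  have mult_decode: "multiples R n (u j) \<subseteq> decode n e" if "j \<in> {1..l}" for j
    using u_decode[OF that] R_subgroup_decode[OF e] by (auto simp: R_subgroup_iff multiples_def)
  have decode_vec: "decode n e \<subseteq> carrier (vec_group R n)"
    by (auto simp: decode_def carrier_vec_group)
  let ?X = "\<Pi>\<^sub>E j\<in>{1..l}. multiples R n (u j)"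
  let ?sum = "\<lambda>x. finprod (vec_group R n) x {1..l}"
  have X_ex: "\<exists>r\<in>carrier R. x j = scalar_mult R n (u j) r" if "x \<in> ?X" "j \<in> {1..l}" for x j
    using PiE_mem[OF that] by (auto simp: multiples_def)
  have X_closed: "x j (g j) \<in> carrier R" if "x \<in> ?X" "j \<in> {1..l}" for x j
    using X_ex[OF that] mult_pivot[OF that(2) that(2)] by auto
  have sum_decode: "?sum x \<in> decode n e" if "x \<in> ?X" for x
    using that mult_decode by (intro finprod_R_subgroup[OF R_subgroup_decode[OF e]]) fastforce+
  \<comment> \<open>Only the summand \<open>x k\<close> is possibly nonzero at the pivot
    \<open>g k\<close>, so the sum determines every coefficient.\<close>
  have sum_pivot: "?sum x (g k) = x k (g k)" if x: "x \<in> ?X" and k: "k \<in> {1..l}" for x k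
  proof -
    have "x j \<in> carrier (vec_group R n)" if "j \<in> {1..l}" for j
      using PiE_mem[OF x that] mult_decode[OF that] decode_vec by blast
    then have "?sum x (g k) = (\<Oplus>j\<in>{1..l}. x j (g k))"
      using pivotsD(1)[OF g_piv[OF k]] by (intro finprod_vec_group) auto
    also have "\<dots> = (\<Oplus>j\<in>{1..l}. if k = j then x j (g j) else \<zero>)"
    proof (rule finsum_cong')
      fix j assume j: "j \<in> {1..l}"
      show "x j (g k) = (if k = j then x j (g j) else \<zero>)"
        using X_ex[OF x j] mult_pivot[OF j k] by auto
    qed (use X_closed[OF x] in auto)
    also have "\<dots> = x k (g k)"
      using k X_closed[OF x] by (intro finsum_singleton) auto
    finally show ?thesis .
  qed
  have "bij_betw ?sum ?X (decode n e)"
    unfolding bij_betw_def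
  proof (intro conjI inj_onI equalityI subsetI)
    fix x y assume x: "x \<in> ?X" and y: "y \<in> ?X" and eq: "?sum x = ?sum y"
    show "x = y"
    proof (rule PiE_ext[OF x y])
      fix j assume j: "j \<in> {1..l}"
      have "x j (g j) = y j (g j)"
        using sum_pivot[OF x j] sum_pivot[OF y j] eq by simp
      then show "x j = y j"
        using X_ex[OF x j] X_ex[OF y j] mult_pivot[OF j j] by auto
    qed
  next
    fix t assume t: "t \<in> decode n e"
    define x where "x = (\<lambda>j\<in>{1..l}. scalar_mult R n (u j) (t (g j)))"
    have t_closed: "t (g j) \<in> carrier R" if "j \<in> {1..l}" for j
      using R_subgroup_closed[OF R_subgroup_decode[OF e] t pivotsD(1)[OF g_piv[OF that]]] .
    have x: "x \<in> ?X"
      using t_closed by (auto simp: x_def multiples_def)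
    have "t = ?sum x"
    proof (rule decode_eqI[OF e t sum_decode[OF x]])
      fix m assume "m \<in> pivots n e"
      then obtain j where "j \<in> {1..l}" "m = g j"
        using bij_betw_imp_surj_on[OF g] by blast
      then show "t m = ?sum x m"
        using sum_pivot[OF x] mult_pivot t_closed by (simp add: x_def)
    qed
    then show "t \<in> ?sum ` ?X"
      using x by blast
  qed (use sum_decode in auto)
  then have "internal_direct_sum (vec_group R n) {1..l} (\<lambda>j. multiples R n (u j)) (decode n e)"
    using sub by (simp add: internal_direct_sum_def R_subgroup_def)
  moreover have "u j \<in> carrier (vec_group R n) \<and> u j \<noteq> \<one>\<^bsub>vec_group R n\<^esub>" if "j \<in> {1..l}" for j
    using u_vec[OF that] u_pivot[OF that that] one_not_zero pivotsD(1)[OF g_piv[OF that]]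
    by (auto simp: carrier_vec_group one_vec_group)
  moreover have "disjoint_family_on (\<lambda>j. supp R n (u j)) {1..l}"
    using g_eq by (auto simp: disjoint_family_on_def supp_def u_def generator_def split: if_splits)
  ultimately show ?thesis
    unfolding has_disjoint_decomposition_def by blast
qed

lemma dimension_decode: "e \<in> codes n l \<Longrightarrow> dimension R n (decode n e) = l"
  by (intro dimension_eqI has_disjoint_decomposition_decode)

end

subsection \<open>From subgroups to codes\<close>

lemma (in abelian_group) minus_eq_zero_iff:
  "\<lbrakk>x \<in> carrier G; y \<in> carrier G\<rbrakk> \<Longrightarrow> x \<ominus> y = \<zero> \<longleftrightarrow> x = y"
  by (metis a_inv_closed a_minus_def minus_equality minus_minus r_neg)

context finite_nearfield
begin

text \<open>The factor is common to all of \<open>T\<close> and stands on the left, as in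
  \<open>decode\<close>; being nonzero, it makes the relation symmetric. Coordinates that vanish on
  \<open>T\<close> are tied to one another and have to be treated separately.\<close>

definition tied :: "(nat \<Rightarrow> 'a) set \<Rightarrow> nat \<Rightarrow> nat \<Rightarrow> bool" where
  "tied T i j \<longleftrightarrow> (\<exists>c\<in>carrier R - {\<zero>}. \<forall>t\<in>T. t i = c \<otimes> t j)"

lemma tied_refl:
  assumes "R_subgroup R n T" "i \<in> {1..n}"
  shows "tied T i i"
  unfolding tied_def using assms one_closed one_not_zero
  by (intro bexI[of _ \<one>]) (auto simp: one_mult R_subgroup_closed)

lemma tied_sym:
  assumes T: "R_subgroup R n T" and j: "j \<in> {1..n}" and tied: "tied T i j"
  shows "tied T j i"
proof -
  obtain c where c: "c \<in> carrier R" "c \<noteq> \<zero>" "\<And>t. t \<in> T \<Longrightarrow> t i = c \<otimes> t j"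
    using tied by (auto simp: tied_def)
  obtain d where d: "d \<in> carrier R" "d \<noteq> \<zero>" "d \<otimes> c = \<one>"
    using c inverse_exists by metis
  have "t j = d \<otimes> t i" if "t \<in> T" for t
    unfolding c(3)[OF that] using c d R_subgroup_closed[OF T that j]
    by (simp add: m_assoc[symmetric] one_mult)
  then show ?thesis
    using d by (auto simp: tied_def)
qed

lemma tied_trans:
  assumes T: "R_subgroup R n T" and k: "k \<in> {1..n}" and ij: "tied T i j" and jk: "tied T j k"
  shows "tied T i k"
proof -
  obtain c where c: "c \<in> carrier R" "c \<noteq> \<zero>" "\<And>t. t \<in> T \<Longrightarrow> t i = c \<otimes> t j"
    using ij by (auto simp: tied_def)
  obtain d where d: "d \<in> carrier R" "d \<noteq> \<zero>" "\<And>t. t \<in> T \<Longrightarrow> t j = d \<otimes> t k"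
    using jk by (auto simp: tied_def)
  have "t i = (c \<otimes> d) \<otimes> t k" if "t \<in> T" for t
    unfolding c(3)[OF that] d(3)[OF that] using c d R_subgroup_closed[OF T that k]
    by (simp add: m_assoc)
  then show ?thesis
    using c d m_closed mult_nonzero unfolding tied_def by blast
qed

text \<open>Scale to \<open>w\<close> with entry one at \<open>i\<close>. If \<open>w j\<close> is
  nonzero, it fails as a tying factor for some \<open>t\<close>, so subtracting from
  \<open>t\<close> a multiple of \<open>w\<close> gives \<open>s\<close> that vanishes at
  \<open>i\<close> but not at \<open>j\<close>. A multiple of \<open>s\<close> then clears
  coordinate \<open>j\<close> of \<open>w\<close> and keeps the one at \<open>i\<close>.\<close>

lemma R_subgroup_separate:
  assumes T: "R_subgroup R n T" and ij: "i \<in> {1..n}" "j \<in> {1..n}"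
    and active: "t \<in> T" "t i \<noteq> \<zero>" and untied: "\<not> tied T j i"
  obtains u where "u \<in> T" "u i \<noteq> \<zero>" "u j = \<zero>"
proof -
  obtain w where w: "w \<in> T" "w i = \<one>"
    using R_subgroup_normalize[OF T active(1) ij(1) active(2)] by blast
  note closed = R_subgroup_closed[OF T]
  show thesis
  proof (cases "w j = \<zero>")
    case True
    then show thesis
      using w one_not_zero that by metis
  next
    case False
    then obtain t where t: "t \<in> T" "t j \<noteq> w j \<otimes> t i"
      using untied closed[OF w(1) ij(2)] unfolding tied_def by blast
    define s where "s = (\<lambda>k\<in>{1..n}. t k \<ominus> w k \<otimes> t i)"
    have s: "s \<in> T"
      unfolding s_def by (rule R_subgroup_diff[OF T t(1) w(1) closed[OF t(1) ij(1)]])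
    have si: "s i = \<zero>"
      using ij(1) w closed[OF t(1) ij(1)] by (simp add: s_def one_mult minus_eq_zero_iff)
    have "s j \<noteq> \<zero>"
      using ij closed[OF t(1)] closed[OF w(1)] t(2)
      by (simp add: s_def m_closed minus_eq_zero_iff)
    then obtain r where r: "r \<in> carrier R" "s j \<otimes> r = \<one>"
      using inverse_exists closed[OF s ij(2)] by metis
    define x where "x = (\<lambda>k\<in>{1..n}. w k \<ominus> s k \<otimes> (r \<otimes> w j))"
    have x: "x \<in> T"
      unfolding x_def using r closed[OF w(1) ij(2)]
      by (intro R_subgroup_diff[OF T w(1) s] m_closed)
    have "x i = \<one>"
      using ij(1) si w r closed[OF w(1) ij(2)]
      by (simp add: x_def zero_mult m_closed one_closed a_minus_def)
    moreover have "x j = \<zero>"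
      using ij(2) r closed[OF w(1) ij(2)] closed[OF s ij(2)]
      by (simp add: x_def m_assoc[symmetric] one_mult minus_eq_zero_iff)
    ultimately show thesis
      using that[OF x] one_not_zero by simp
  qed
qed

text \<open>The code of \<open>T\<close> sends a coordinate that vanishes on \<open>T\<close> to itself and any other one to the
  least coordinate it is tied to.\<close>

lemma R_subgroup_code:
  assumes T: "R_subgroup R n T"
  obtains e l where "e \<in> codes n l" "T \<subseteq> decode n e"
    "\<And>m. m \<in> pivots n e \<Longrightarrow> \<exists>t\<in>T. t m \<noteq> \<zero>"
    "\<And>m k. \<lbrakk>m \<in> pivots n e; k \<in> pivots n e; tied T m k\<rbrakk> \<Longrightarrow> m = k"
proof -
  define vanish where "vanish i \<longleftrightarrow> (\<forall>t\<in>T. t i = \<zero>)" for i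
  define least where "least i m \<longleftrightarrow> m \<in> {1..i} \<and> tied T i m \<and> (\<forall>k\<in>{1..<m}. \<not> tied T i k)" for i m
  define good where "good i p \<longleftrightarrow> (if vanish i then p = (i, \<zero>) else
    least i (fst p) \<and> snd p \<in> carrier R - {\<zero>} \<and> (\<forall>t\<in>T. t i = snd p \<otimes> t (fst p)))" for i p
  have "\<exists>p. good i p" if i: "i \<in> {1..n}" for i
  proof (cases "vanish i")
    case False
    \<comment> \<open>The bound excludes the number zero, which is not a coordinate. Reflexivity of
      \<open>tied\<close> provides the witness \<open>i\<close>, hence
      \<open>m \<le> i\<close>.\<close>
    define m where "m = (LEAST m. 1 \<le> m \<and> tied T i m)"
    have "1 \<le> i \<and> tied T i i"
      using tied_refl[OF T i] i by simp
    then have "1 \<le> m \<and> tied T i m" "m \<le> i"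
      unfolding m_def by (rule LeastI, rule Least_le)
    moreover have "\<not> (1 \<le> k \<and> tied T i k)" if "k < m" for k
      using that unfolding m_def by (rule not_less_Least)
    ultimately have "least i m"
      by (simp add: least_def)
    moreover obtain c where "c \<in> carrier R - {\<zero>}" "\<forall>t\<in>T. t i = c \<otimes> t m"
      using \<open>1 \<le> m \<and> tied T i m\<close> by (auto simp: tied_def)
    ultimately have "good i (m, c)"
      using False by (simp add: good_def)
    then show ?thesis ..
  qed (simp add: good_def)
  then obtain e' where e': "\<And>i. i \<in> {1..n} \<Longrightarrow> good i (e' i)"
    by metis
  define e where "e = restrict e' {1..n}"
  have e: "good i (e i)" if "i \<in> {1..n}" for i
    using e'[OF that] that by (simp add: e_def)
  have live: "least i (fst (e i))" "snd (e i) \<in> carrier R - {\<zero>}"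
    "\<And>t. t \<in> T \<Longrightarrow> t i = snd (e i) \<otimes> t (fst (e i))"
    if i: "i \<in> {1..n}" and nv: "\<not> vanish i" for i
    using e[OF i] unfolding good_def if_not_P[OF nv] by blast+
  note closed = R_subgroup_closed[OF T]
  have fst_closed: "fst (e i) \<in> {1..n}" if "i \<in> {1..n}" for i
    using e[OF that] that by (auto simp: good_def least_def split: if_splits)
  \<comment> \<open>The chosen factor is known only through its equation; cancelling a nonzero
    \<open>t i\<close> on the right shows that it is one.\<close>
  have self: "e i = (i, \<one>)" if i: "i \<in> {1..n}" and nv: "\<not> vanish i" and fst: "fst (e i) = i" for i
  proof -
    obtain t where t: "t \<in> T" "t i \<noteq> \<zero>"
      using nv by (auto simp: vanish_def)
    have "snd (e i) \<otimes> t i = \<one> \<otimes> t i"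
      using live(3)[OF i nv t(1)] one_mult[OF closed[OF t(1) i]] unfolding fst by metis
    then have "snd (e i) = \<one>"
      using mult_right_cancel live(2)[OF i nv] one_closed closed[OF t(1) i] t(2) by blast
    then show ?thesis
      using fst by (simp add: prod_eq_iff)
  qed
  \<comment> \<open>The least coordinate tied to \<open>?m\<close> is, by transitivity, tied to
    \<open>i\<close> as well, so minimality of \<open>?m\<close> makes it \<open>?m\<close>
    itself.\<close>
  have piv: "fst (e i) \<in> pivots n e" if i: "i \<in> {1..n}" and nv: "\<not> vanish i" for i
  proof -
    let ?m = "fst (e i)"
    have m: "?m \<in> {1..n}" by (rule fst_closed[OF i])
    have im: "tied T i ?m" and least: "\<And>k. k \<in> {1..<?m} \<Longrightarrow> \<not> tied T i k"
      using live(1)[OF i nv] by (simp_all add: least_def)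
    obtain t where t: "t \<in> T" "t i \<noteq> \<zero>"
      using nv by (auto simp: vanish_def)
    have "t ?m \<noteq> \<zero>"
      using live(2,3)[OF i nv] t mult_zero by (metis DiffD1)
    then have nvm: "\<not> vanish ?m"
      using t by (auto simp: vanish_def)
    have "tied T ?m (fst (e ?m))" and "fst (e ?m) \<in> {1..?m}"
      using live(1)[OF m nvm] by (simp_all add: least_def)
    moreover have "tied T i (fst (e ?m))"
      using tied_trans[OF T fst_closed[OF m] im] calculation by blast
    ultimately have "fst (e ?m) = ?m"
      using least by fastforce
    then show ?thesis
      using self[OF m nvm] m by (simp add: pivots_def)
  qed
  have piv_good: "m \<in> {1..n}" "\<not> vanish m" "\<And>k. k \<in> {1..<m} \<Longrightarrow> \<not> tied T m k"
    if "m \<in> pivots n e" for m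
  proof -
    show m: "m \<in> {1..n}"
      using that by (simp add: pivots_def)
    have "e m = (m, \<one>)"
      using that by (simp add: pivots_def)
    then show nv: "\<not> vanish m"
      using e[OF m] one_not_zero by (auto simp: good_def)
    show "\<not> tied T m k" if "k \<in> {1..<m}" for k
      using live(1)[OF m nv] that \<open>e m = (m, \<one>)\<close> by (simp add: least_def)
  qed
  have "e i = (i, \<zero>) \<or> e i = (i, \<one>) \<or>
      (\<exists>m\<in>pivots n e. \<exists>c\<in>carrier R - {\<zero>}. m < i \<and> e i = (m, c))" if i: "i \<in> {1..n}" for i
  proof (cases "vanish i")
    case True
    then show ?thesis using e[OF i] by (simp add: good_def)
  next
    case False
    then have "fst (e i) \<le> i" "snd (e i) \<in> carrier R - {\<zero>}"
      using live(1,2)[OF i] by (simp_all add: least_def)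
    then show ?thesis
      using self[OF i False] piv[OF i False]
      by (cases "fst (e i) = i") (auto intro!: bexI[of _ "fst (e i)"] bexI[of _ "snd (e i)"])
  qed
  then have "e \<in> codes n (card (pivots n e))"
    by (simp add: codes_def e_def)
  moreover have "T \<subseteq> decode n e"
  proof
    fix t assume t: "t \<in> T"
    have "snd (e i) \<otimes> t (fst (e i)) = t i" if i: "i \<in> {1..n}" for i
    proof (cases "vanish i")
      case True
      then have "e i = (i, \<zero>)" "t i = \<zero>"
        using e[OF i] t by (simp_all add: good_def vanish_def)
      then show ?thesis
        by (simp add: zero_mult)
    next
      case False
      then show ?thesis
        using live(3)[OF i False t] by simp
    qed
    then show "t \<in> decode n e"
      using T t by (auto simp: decode_def R_subgroup_iff)
  qed
  moreover have "\<exists>t\<in>T. t m \<noteq> \<zero>" if "m \<in> pivots n e" for m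
    using piv_good(2)[OF that] by (simp add: vanish_def)
  moreover have "m = k" if mk: "m \<in> pivots n e" "k \<in> pivots n e" "tied T m k" for m k
  proof (rule linorder_cases[of m k])
    assume "m < k"
    then show ?thesis
      using piv_good[OF mk(2)] piv_good(1)[OF mk(1)] tied_sym[OF T _ mk(3)] by simp
  next
    assume "k < m"
    then show ?thesis
      using piv_good[OF mk(1)] piv_good(1)[OF mk(2)] mk(3) by simp
  qed
  ultimately show thesis
    by (rule that)
qed

end

section \<open>Isolating pivots by means of properness\<close>

locale finite_proper_nearfield = finite_nearfield + proper_nearfield
begin

text \<open>Where one of the normalized vectors vanishes, associativity makes the two parts of
  \<open>x\<close> cancel. At \<open>i\<close> both have entry one, so \<open>x i\<close> is the
  defect of right distributivity for \<open>a\<close>, \<open>b\<close>, \<open>c\<close>.\<close>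

lemma R_subgroup_supp_Int:
  assumes T: "R_subgroup R n T" and vw: "v \<in> T" "w \<in> T"
    and i: "i \<in> {1..n}" "v i \<noteq> \<zero>" "w i \<noteq> \<zero>"
  obtains x where "x \<in> T" "x i \<noteq> \<zero>"
    "\<And>j. \<lbrakk>j \<in> {1..n}; v j = \<zero> \<or> w j = \<zero>\<rbrakk> \<Longrightarrow> x j = \<zero>"
proof -
  obtain v' where v': "v' \<in> T" "v' i = \<one>" "\<And>j. \<lbrakk>j \<in> {1..n}; v j = \<zero>\<rbrakk> \<Longrightarrow> v' j = \<zero>"
    using R_subgroup_normalize[OF T vw(1) i(1,2)] by blast
  obtain w' where w': "w' \<in> T" "w' i = \<one>" "\<And>j. \<lbrakk>j \<in> {1..n}; w j = \<zero>\<rbrakk> \<Longrightarrow> w' j = \<zero>"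
    using R_subgroup_normalize[OF T vw(2) i(1,3)] by blast
  obtain a b c where abc: "a \<in> carrier R" "b \<in> carrier R" "c \<in> carrier R"
    and neq: "(a \<oplus> b) \<otimes> c \<noteq> a \<otimes> c \<oplus> b \<otimes> c"
    using not_distrib_right by blast
  define p where "p = (\<lambda>j\<in>{1..n}. v' j \<otimes> a \<oplus> w' j \<otimes> b)"
  define q where "q = (\<lambda>j\<in>{1..n}. v' j \<otimes> (a \<otimes> c) \<oplus> w' j \<otimes> (b \<otimes> c))"
  define x where "x = (\<lambda>j\<in>{1..n}. p j \<otimes> c \<oplus> q j \<otimes> (\<ominus> \<one>))"
  have pq: "p \<in> T" "q \<in> T"
    unfolding p_def q_def
    by (intro R_subgroup_combination T v' w' abc m_closed)+
  have "x \<in> T"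
    unfolding x_def using T pq abc one_closed by (intro R_subgroup_combination) auto
  have x_eq: "x j = (v' j \<otimes> a \<oplus> w' j \<otimes> b) \<otimes> c \<ominus> (v' j \<otimes> (a \<otimes> c) \<oplus> w' j \<otimes> (b \<otimes> c))"
    if j: "j \<in> {1..n}" for j
  proof -
    have "q j \<in> carrier R"
      by (rule R_subgroup_closed[OF T pq(2) j])
    then have "x j = p j \<otimes> c \<ominus> q j"
      using j by (simp add: x_def a_minus_def mult_minus mult_one one_closed)
    then show ?thesis
      using j by (simp add: p_def q_def)
  qed
  have closed: "v' j \<in> carrier R" "w' j \<in> carrier R" if "j \<in> {1..n}" for j
    using R_subgroup_closed[OF T] v' w' that by auto
  have "x j = \<zero>" if j: "j \<in> {1..n}" "v j = \<zero> \<or> w j = \<zero>" for j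
  proof -
    have "v' j = \<zero> \<or> w' j = \<zero>"
      using v'(3) w'(3) j by blast
    then show ?thesis
      using x_eq[OF j(1)] closed[OF j(1)] abc
      by (auto simp: zero_mult m_closed m_assoc a_minus_def r_neg)
  qed
  moreover have "x i \<noteq> \<zero>"
  proof -
    have "x i = (a \<oplus> b) \<otimes> c \<ominus> (a \<otimes> c \<oplus> b \<otimes> c)"
      using x_eq[OF i(1)] v'(2) w'(2) abc by (simp add: one_mult m_closed)
    then show ?thesis
      using neq abc by (simp add: m_closed minus_eq_zero_iff)
  qed
  ultimately show thesis
    using that \<open>x \<in> T\<close> by blast
qed

text \<open>Induction on \<open>J\<close>: a vector vanishing on the old set and one separating
  \<open>i\<close> from the new coordinate are combined by intersecting supports, which keeps
  \<open>i\<close>.\<close>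

lemma R_subgroup_isolate:
  assumes T: "R_subgroup R n T" and i: "i \<in> {1..n}" and active: "\<exists>t\<in>T. t i \<noteq> \<zero>"
    and "finite J" "J \<subseteq> {1..n}" "\<And>j. j \<in> J \<Longrightarrow> \<not> tied T j i"
  shows "\<exists>u\<in>T. u i \<noteq> \<zero> \<and> (\<forall>j\<in>J. u j = \<zero>)"
  using assms(4-6)
proof (induction J)
  case empty
  then show ?case using active by simp
next
  case (insert j J)
  then obtain v where v: "v \<in> T" "v i \<noteq> \<zero>" "\<forall>k\<in>J. v k = \<zero>"
    by auto
  obtain w where w: "w \<in> T" "w i \<noteq> \<zero>" "w j = \<zero>"
    using R_subgroup_separate[OF T i _ v(1,2), of j] insert.prems by auto
  obtain x where x: "x \<in> T" "x i \<noteq> \<zero>"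
    "\<And>k. \<lbrakk>k \<in> {1..n}; v k = \<zero> \<or> w k = \<zero>\<rbrakk> \<Longrightarrow> x k = \<zero>"
    using R_subgroup_supp_Int[OF T v(1) w(1) i v(2) w(2)] by blast
  then show ?case
    using v w insert.prems by (intro bexI[of _ x]) auto
qed

lemma R_subgroup_eq_decode:
  assumes T: "R_subgroup R n T"
  obtains e l where "e \<in> codes n l" "T = decode n e"
proof -
  obtain e l where e: "e \<in> codes n l" and sub: "T \<subseteq> decode n e"
    and active: "\<And>m. m \<in> pivots n e \<Longrightarrow> \<exists>t\<in>T. t m \<noteq> \<zero>"
    and untied: "\<And>m k. \<lbrakk>m \<in> pivots n e; k \<in> pivots n e; tied T m k\<rbrakk> \<Longrightarrow> m = k"
    using R_subgroup_code[OF T] by blast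
  have gen: "\<exists>u\<in>T. u m = \<one> \<and> (\<forall>k\<in>pivots n e - {m}. u k = \<zero>)" if m: "m \<in> pivots n e" for m
  proof -
    have "\<exists>u\<in>T. u m \<noteq> \<zero> \<and> (\<forall>k\<in>pivots n e - {m}. u k = \<zero>)"
      using R_subgroup_isolate[OF T pivotsD(1)[OF m] active[OF m], of "pivots n e - {m}"]
        untied m finite_pivots pivotsD(1) by blast
    then obtain u where "u \<in> T" "u m \<noteq> \<zero>" "\<forall>k\<in>pivots n e - {m}. u k = \<zero>"
      by blast
    then show ?thesis
      using R_subgroup_normalize[OF T _ pivotsD(1)[OF m], of u] pivotsD(1) by (metis DiffD1)
  qed
  note D = R_subgroup_decode[OF e]
  \<comment> \<open>Elimination over a set \<open>A\<close> that contains all pivots where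
    \<open>t\<close> is nonzero: subtracting a multiple of the vector isolated at \<open>m\<close>
    clears \<open>m\<close> and no other pivot entry changes. A solution that is zero at all pivots
    is the zero vector.\<close>
  have "t \<in> T" if "finite A" "t \<in> decode n e" "{m \<in> pivots n e. t m \<noteq> \<zero>} \<subseteq> A" "A \<subseteq> pivots n e" for A t
    using that
  proof (induction A arbitrary: t)
    case empty
    then have "t = (\<lambda>i\<in>{1..n}. \<zero>)"
      using R_subgroup_zero[OF D] pivotsD(1) by (intro decode_eqI[OF e]) auto
    then show ?case
      using R_subgroup_zero[OF T] by (simp only:)
  next
    case (insert m A)
    then have m: "m \<in> pivots n e" by simp
    then obtain u where u: "u \<in> T" "u m = \<one>" "\<forall>k\<in>pivots n e - {m}. u k = \<zero>"
      using gen by blast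
    note t = \<open>t \<in> decode n e\<close>
    note tc = R_subgroup_closed[OF D t]
    have tm: "t m \<in> carrier R"
      by (rule tc[OF pivotsD(1)[OF m]])
    define s where "s = (\<lambda>i\<in>{1..n}. t i \<ominus> u i \<otimes> t m)"
    have "s \<in> T"
    proof (rule insert.IH)
      show "s \<in> decode n e"
        unfolding s_def using R_subgroup_diff[OF D t _ tm] u(1) sub by blast
      have "s m = \<zero>"
        using pivotsD(1)[OF m] u(2) tm by (simp add: s_def one_mult minus_eq_zero_iff)
      moreover have "s k = t k" if "k \<in> pivots n e" "k \<noteq> m" for k
        using that pivotsD(1)[of k n e] u(3) tc[of k] tm
        by (simp add: s_def zero_mult a_minus_def)
      ultimately have "{k \<in> pivots n e. s k \<noteq> \<zero>} \<subseteq> {k \<in> pivots n e. t k \<noteq> \<zero>} - {m}"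
        by (intro subsetI) (metis (mono_tags, lifting) Diff_iff mem_Collect_eq singletonD)
      then show "{k \<in> pivots n e. s k \<noteq> \<zero>} \<subseteq> A"
        using insert.prems(2) by blast
    qed (use insert.prems in auto)
    \<comment> \<open>Adding the subtracted multiple back recovers \<open>t\<close>, now as a
      combination of two elements of \<open>T\<close>.\<close>
    then have "(\<lambda>i\<in>{1..n}. s i \<otimes> \<one> \<oplus> u i \<otimes> t m) \<in> T"
      using u(1) tm one_closed by (intro R_subgroup_combination[OF T])
    moreover have "(\<lambda>i\<in>{1..n}. s i \<otimes> \<one> \<oplus> u i \<otimes> t m) = restrict t {1..n}"
      using tc tm R_subgroup_closed[OF T u(1)]
      by (intro restrict_ext) (simp add: s_def mult_one m_closed a_minus_def a_assoc l_neg)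
    moreover have "t \<in> {1..n} \<rightarrow>\<^sub>E carrier R"
      using t unfolding decode_def by blast
    ultimately show ?case
      by (simp only: PiE_restrict)
  qed
  then have "decode n e \<subseteq> T"
    using finite_pivots by blast
  then show thesis
    using that[OF e] sub by blast
qed

lemma Sub_eq_card_codes: "Sub R l n = card (codes n l)"
proof -
  have "{T. R_subgroup R n T \<and> dimension R n T = l} = decode n ` codes n l"
  proof (intro equalityI subsetI)
    fix T assume "T \<in> {T. R_subgroup R n T \<and> dimension R n T = l}"
    then have T: "R_subgroup R n T" "dimension R n T = l"
      by simp_all
    obtain e k where "e \<in> codes n k" "T = decode n e"
      using R_subgroup_eq_decode[OF T(1)] .
    then show "T \<in> decode n ` codes n l"
      using T(2) dimension_decode by blast
  qed (auto simp: R_subgroup_decode dimension_decode)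
  moreover have "inj_on (decode n) (codes n l)"
    by (rule inj_on_subset[OF inj_on_decode]) auto
  ultimately show ?thesis
    by (simp add: Sub_def card_image)
qed

end

text \<open>Writing the range as \<open>d + l \<le> n\<close> makes the sum empty for
  \<open>l > n\<close>; truncated subtraction would leave the index zero in
  \<open>{0..n - l}\<close>.\<close>

theorem theorem30:
  fixes R :: "('a, 'b) ring_scheme" and l n :: nat
  assumes "proper_nearfield R" and "finite (carrier R)"
  shows "Sub R l n =
    (\<Sum>d | d + l \<le> n. (n choose d) * Stirling (n - d) l * (card (carrier R) - 1) ^ (n - d - l))"
proof -
  interpret proper_nearfield R by fact
  interpret finite_proper_nearfield R
    by unfold_locales fact
  show ?thesis
    by (simp only: Sub_eq_card_codes card_codes)
qed

end
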